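(* If $T$ is a ditree such that $\delta^-(T)\ge 1$, then $\rho^{\rm o}(T)=\gamma_t(T)$.
   Context: All digraphs are finite, and their arc relation is irreflexive (no loops); both arcs $uv$ and $vu$ may be present. For a digraph $D$ and vertex $v$, $N^+_D(v)$ is the set of out-neighbors of $v$ and $N^-_D(v)$ the set of in-neighbors. $\delta^-(D)$ is the minimum in-degree $\min_v|N^-_D(v)|$. The underlying graph of $D$ is the undirected graph on $V(D)$ in which $u,v$ are adjacent iff at least one of the arcs $uv$, $vu$ is in $D$; a ditree is a digraph whose underlying graph is a tree. If $\delta^-(D)\ge1$, a set $S$ is a total dominating set if $\bigcup_{v\in S}N^+_D(v)=V(D)$, and $\gamma_t(D)$ is the minimum size of a total dominating set. A set $B\subseteq V(D)$ is an open packing if $N^-_D(u)\cap N^-_D(v)=\emptyset$ for all distinct $u,v\in B$; $\rho^{\rm o}(D)$ is the maximum size of an open packing. *)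

theory Defs
  imports "Graph_Theory.Graph_Theory"
begin

text \<open>
  Digraphs are those of the locale \<^locale>\<open>digraph\<close>: finite, loopless, without parallel
  arcs, opposite arcs allowed.  The relation \<^const>\<open>dominates\<close> is the arc relation.
\<close>

definition out_neighbors :: "('a, 'b) pre_digraph \<Rightarrow> 'a \<Rightarrow> 'a set" where
  "out_neighbors D v = {w \<in> verts D. v \<rightarrow>\<^bsub>D\<^esub> w}"

definition in_neighbors :: "('a, 'b) pre_digraph \<Rightarrow> 'a \<Rightarrow> 'a set" where
  "in_neighbors D v = {u \<in> verts D. u \<rightarrow>\<^bsub>D\<^esub> v}"

definition min_in_degree :: "('a, 'b) pre_digraph \<Rightarrow> nat" where
  "min_in_degree D = Min ((\<lambda>v. card (in_neighbors D v)) ` verts D)"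

text \<open>
  \<^term>\<open>mk_symmetric D\<close> encodes the underlying graph of \<^term>\<open>D\<close>: each edge is a pair of
  opposite arcs.  In this encoding \<open>u, v, u\<close> is a directed cycle along a single edge, so
  \<^const>\<open>forest\<close> and \<^const>\<open>tree\<close> do not express acyclicity of an undirected graph;
  its cycles are the directed cycles of length at least three.
  \<^term>\<open>connected D\<close> is connectedness of the underlying graph and entails that \<^term>\<open>D\<close>
  has a vertex.
\<close>

definition ditree :: "('a, 'b) pre_digraph \<Rightarrow> bool" where
  "ditree D \<longleftrightarrow> digraph D \<and> connected D \<and>
    \<not> (\<exists>p. pre_digraph.cycle (with_proj (mk_symmetric D)) p \<and> 3 \<le> length p)"

definition total_dominating_set :: "('a, 'b) pre_digraph \<Rightarrow> 'a set \<Rightarrow> bool" where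
  "total_dominating_set D S \<longleftrightarrow> S \<subseteq> verts D \<and> (\<Union>v\<in>S. out_neighbors D v) = verts D"

text \<open>Meaningful only if the minimum in-degree is positive; otherwise there is no such set.\<close>

definition total_domination_number :: "('a, 'b) pre_digraph \<Rightarrow> nat" where
  "total_domination_number D = Min (card ` {S. total_dominating_set D S})"

definition open_packing :: "('a, 'b) pre_digraph \<Rightarrow> 'a set \<Rightarrow> bool" where
  "open_packing D B \<longleftrightarrow> B \<subseteq> verts D \<and>
    (\<forall>u\<in>B. \<forall>v\<in>B. u \<noteq> v \<longrightarrow> in_neighbors D u \<inter> in_neighbors D v = {})"

definition open_packing_number :: "('a, 'b) pre_digraph \<Rightarrow> nat" where
  "open_packing_number D = Max (card ` {B. open_packing D B})"

end

theory Submission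
  imports Defs
begin

text \<open>
  A forest has an elimination order in which every vertex has at most one later neighbour, its
  parent.  Total dominating sets are the transversals of the in-neighbourhoods, and open packings
  are the subfamilies of pairwise disjoint in-neighbourhoods.  Among the vertices not yet
  dominated, take the first one \<open>v\<close> in the elimination order: an in-neighbourhood of
  another undominated vertex can meet that of \<open>v\<close> only in the parent of \<open>v\<close>.
  Hence putting \<open>v\<close> into the packing and the parent of \<open>v\<close> (or any in-neighbour, if
  the parent is none) into the dominating set leaves only vertices whose in-neighbourhoods are
  disjoint from that of \<open>v\<close>.  The greedy procedure thus yields a packing and a dominating
  set of the same size, and no packing is larger than a dominating set.
\<close>

text \<open>The assumption ranges over all nonempty \<open>W\<close> so that it is inherited by the
  members still to be hit. Confining \<open>S\<close> to the union of the sets \<open>N v\<close>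
  later ensures that \<open>S\<close> consists of vertices.\<close>

lemma greedy_packing_transversal:
  fixes N :: "'i \<Rightarrow> 'a set"
  assumes "finite U"
    and "\<And>W. W \<subseteq> U \<Longrightarrow> W \<noteq> {} \<Longrightarrow>
      \<exists>v\<in>W. \<exists>x\<in>N v. \<forall>w\<in>W. N v \<inter> N w \<noteq> {} \<longrightarrow> x \<in> N w"
  shows "\<exists>B S. B \<subseteq> U \<and> (\<forall>u\<in>B. \<forall>v\<in>B. u \<noteq> v \<longrightarrow> N u \<inter> N v = {}) \<and>
    S \<subseteq> \<Union>(N ` U) \<and> card S \<le> card B \<and> (\<forall>v\<in>U. S \<inter> N v \<noteq> {})"
  using assms
proof (induction U rule: finite_psubset_induct)
  case (psubset U)
  show ?case
  proof (cases "U = {}")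
    case True
    then show ?thesis by auto
  next
    case False
    then obtain v x where v: "v \<in> U" "x \<in> N v"
      and vx: "\<And>w. w \<in> U \<Longrightarrow> N v \<inter> N w \<noteq> {} \<Longrightarrow> x \<in> N w"
      using psubset.prems[of U] by blast
    \<comment> \<open>The members containing \<open>x\<close> are hit already; by the choice of
      \<open>x\<close>, all others are disjoint from \<open>N v\<close>.\<close>
    define U' where "U' = {w \<in> U. x \<notin> N w}"
    have "U' \<subset> U" using v by (auto simp: U'_def)
    then have "\<exists>B S. B \<subseteq> U' \<and> (\<forall>u\<in>B. \<forall>v\<in>B. u \<noteq> v \<longrightarrow> N u \<inter> N v = {}) \<and>
      S \<subseteq> \<Union>(N ` U') \<and> card S \<le> card B \<and> (\<forall>v\<in>U'. S \<inter> N v \<noteq> {})"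
      by (intro psubset.IH psubset.prems) auto
    then obtain B S where BS: "B \<subseteq> U'" "\<forall>u\<in>B. \<forall>v\<in>B. u \<noteq> v \<longrightarrow> N u \<inter> N v = {}"
      "S \<subseteq> \<Union>(N ` U')" "card S \<le> card B" "\<forall>v\<in>U'. S \<inter> N v \<noteq> {}" by blast
    have "finite B" using BS(1) psubset.hyps by (auto simp: U'_def intro: finite_subset)
    moreover have "v \<notin> B" using BS(1) v by (auto simp: U'_def)
    \<comment> \<open>As \<open>v\<close> is new, the packing grows by exactly one, while the
      transversal grows by at most one.\<close>
    ultimately have "card (insert x S) \<le> card (insert v B)"
      using BS(4) card_insert_le_m1[of "Suc (card B)" S x] by simp
    moreover have "N v \<inter> N w = {}" if "w \<in> B" for w
      using that BS(1) vx[of w] by (auto simp: U'_def)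
    then have "\<forall>u\<in>insert v B. \<forall>w\<in>insert v B. u \<noteq> w \<longrightarrow> N u \<inter> N w = {}"
      using BS(2) by blast
    moreover have "insert x S \<subseteq> \<Union>(N ` U)" using BS(3) v by (auto simp: U'_def)
    moreover have "\<forall>w\<in>U. insert x S \<inter> N w \<noteq> {}" using BS(5) by (auto simp: U'_def)
    moreover have "insert v B \<subseteq> U" using BS(1) v by (auto simp: U'_def)
    ultimately show ?thesis by blast
  qed
qed

text \<open>Keep removing a vertex that has at most one neighbour left; \<open>f\<close> records the
  time of removal.\<close>

lemma elimination_order_exists:
  assumes "finite V"
    and "\<And>W. W \<subseteq> V \<Longrightarrow> W \<noteq> {} \<Longrightarrow>
      \<exists>v\<in>W. \<forall>x\<in>W. \<forall>y\<in>W. (v, x) \<in> R \<longrightarrow> (v, y) \<in> R \<longrightarrow> x = y"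
  shows "\<exists>f :: 'a \<Rightarrow> nat. inj_on f V \<and> (\<forall>v\<in>V. \<forall>x\<in>V. \<forall>y\<in>V.
    (v, x) \<in> R \<longrightarrow> (v, y) \<in> R \<longrightarrow> f v < f x \<longrightarrow> f v < f y \<longrightarrow> x = y)"
  using assms
proof (induction V rule: finite_psubset_induct)
  case (psubset V)
  show ?case
  proof (cases "V = {}")
    case True
    then show ?thesis by auto
  next
    case False
    then obtain v where v: "v \<in> V"
      "\<And>x y. x \<in> V \<Longrightarrow> y \<in> V \<Longrightarrow> (v, x) \<in> R \<Longrightarrow> (v, y) \<in> R \<Longrightarrow> x = y"
      using psubset.prems[of V] by blast
    have "V - {v} \<subset> V" using v by auto
    then have "\<exists>f :: 'a \<Rightarrow> nat. inj_on f (V - {v}) \<and>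
      (\<forall>u\<in>V - {v}. \<forall>x\<in>V - {v}. \<forall>y\<in>V - {v}.
        (u, x) \<in> R \<longrightarrow> (u, y) \<in> R \<longrightarrow> f u < f x \<longrightarrow> f u < f y \<longrightarrow> x = y)"
      by (intro psubset.IH psubset.prems) auto
    then obtain f :: "'a \<Rightarrow> nat" where f: "inj_on f (V - {v})"
      "\<And>u x y. u \<in> V - {v} \<Longrightarrow> x \<in> V - {v} \<Longrightarrow> y \<in> V - {v} \<Longrightarrow>
        (u, x) \<in> R \<Longrightarrow> (u, y) \<in> R \<Longrightarrow> f u < f x \<Longrightarrow> f u < f y \<Longrightarrow> x = y"
      by blast
    \<comment> \<open>The vertex removed first gets time 0 and all other times shift by one, so
      \<open>v\<close> is never later than another vertex.\<close>
    define g where "g = (\<lambda>x. if x = v then 0 else Suc (f x))"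
    have "inj_on g V" using f(1) by (auto simp: g_def inj_on_def)
    moreover have "x = y" if "u \<in> V" "x \<in> V" "y \<in> V" "(u, x) \<in> R" "(u, y) \<in> R"
      "g u < g x" "g u < g y" for u x y
      using that v(2)[of x y] f(2)[of u x y] by (auto simp: g_def split: if_splits)
    ultimately show ?thesis by blast
  qed
qed

text \<open>Paths are handled below as vertex lists, but \<open>cycle\<close> speaks of arc lists;
  this lemma and the next one translate.\<close>

lemma (in pair_pre_digraph) cas_vwalk_arcs: "cas u (vwalk_arcs (u # xs)) (last (u # xs))"
  by (induction xs arbitrary: u) auto

lemma (in pair_pre_digraph) awalk_verts_vwalk_arcs:
  "awalk_verts u (vwalk_arcs (u # xs)) = u # xs"
  by (induction xs arbitrary: u) auto

text \<open>Otherwise every vertex of \<open>W\<close> has two neighbours in \<open>W\<close>. The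
  first vertex of a longest path in \<open>W\<close> then has a neighbour besides the second one; by
  maximality it lies on the path and closes a cycle.\<close>

lemma (in pair_graph) acyclic_low_degree:
  assumes acyclic: "\<not> (\<exists>p. cycle p \<and> 3 \<le> length p)"
    and W: "W \<subseteq> pverts G" "W \<noteq> {}"
  shows "\<exists>v\<in>W. \<forall>x\<in>W. \<forall>y\<in>W. (v, x) \<in> parcs G \<longrightarrow> (v, y) \<in> parcs G \<longrightarrow> x = y"
proof (rule ccontr)
  assume "\<not> ?thesis"
  then have two: "\<exists>y\<in>W. (v, y) \<in> parcs G \<and> y \<noteq> z" if "v \<in> W" for v z
    using that by blast
  let ?path = "\<lambda>xs. xs \<noteq> [] \<and> set xs \<subseteq> W \<and> distinct xs \<and> set (vwalk_arcs xs) \<subseteq> parcs G"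
  have fin: "finite W" using W(1) pair_finite_verts finite_subset by blast
  obtain w where "w \<in> W" using W(2) by blast
  then have "?path [w]" by simp
  moreover have "\<forall>xs. ?path xs \<longrightarrow> length xs < Suc (card W)"
    using fin by (metis card_mono distinct_card less_Suc_eq_le)
  ultimately obtain xs where xs: "?path xs" and
    longest: "\<And>ys. ?path ys \<Longrightarrow> length ys \<le> length xs"
    using ex_has_greatest_nat[of ?path "[w]" length "Suc (card W)"] by blast
  from xs obtain a zs where a: "xs = a # zs" by (cases xs) auto
  with xs have aW: "a \<in> W" by simp
  obtain y where y: "y \<in> W" "(a, y) \<in> parcs G" "zs \<noteq> [] \<Longrightarrow> y \<noteq> hd zs"
    using two[OF aW] by blast
  have sym: "(y, a) \<in> parcs G" using y(2) sym_arcs by (simp add: symmetric_def sym_def)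
  have "y \<noteq> a" using y(2) pair_no_loops[of "(a, y)"] by auto
  moreover have "y \<in> set xs"
  proof (rule ccontr)
    assume "y \<notin> set xs"
    then have "?path (y # xs)" using xs y sym a by auto
    from longest[OF this] show False by simp
  qed
  ultimately have "y \<in> set zs" using a by simp
  then obtain as bs where ab: "zs = as @ y # bs" using split_list by metis
  \<comment> \<open>This rules out going back and forth along a single edge, and gives the cycle its
    length of at least three.\<close>
  have "as \<noteq> []" using ab y(3) by auto
  \<comment> \<open>Follow the path from \<open>a\<close> to \<open>y\<close> and return by the arc
    from \<open>y\<close> to \<open>a\<close>.\<close>
  define p where "p = vwalk_arcs (a # as @ [y, a])"
  have split: "xs = (a # as @ [y]) @ bs" using a ab by simp
  have "set (vwalk_arcs (a # as @ [y])) \<subseteq> parcs G"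
    using xs set_vwalk_arcs_append1[of "a # as @ [y]" bs] unfolding split by blast
  then have "set p \<subseteq> parcs G"
    using set_vwalk_arcs_snoc[of "a # as @ [y]" a] sym by (auto simp: p_def)
  moreover have "a \<in> pverts G" using aW W(1) by blast
  moreover have "cas a p a" using cas_vwalk_arcs[of a "as @ [y, a]"] by (simp add: p_def)
  ultimately have "awalk a p a" by (simp add: awalk_def)
  moreover have "distinct (tl (awalk_verts a p))"
    unfolding p_def awalk_verts_vwalk_arcs using xs split by auto
  moreover have len: "length p = length as + 2"
    using vwalk_length_simp[of "a # as @ [y, a]", unfolded vwalk_length_def] by (simp add: p_def)
  then have "p \<noteq> []" by auto
  ultimately have "cycle p" unfolding cycle_def by blast
  moreover have "3 \<le> length p" using len \<open>as \<noteq> []\<close> by (cases as) auto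
  ultimately show False using acyclic by blast
qed

text \<open>Each vertex of \<open>B\<close> has an in-neighbour in \<open>S\<close>, and
  disjointness of the in-neighbourhoods makes the choice of one injective.\<close>

lemma open_packing_card_le_total_dominating_set:
  assumes "finite (verts D)" "open_packing D B" "total_dominating_set D S"
  shows "card B \<le> card S"
proof -
  have "\<exists>s\<in>S. s \<in> in_neighbors D v" if "v \<in> B" for v
    using that assms(2,3)
    by (fastforce simp: open_packing_def total_dominating_set_def out_neighbors_def in_neighbors_def)
  then obtain g where g: "\<And>v. v \<in> B \<Longrightarrow> g v \<in> S \<and> g v \<in> in_neighbors D v" by metis
  have "inj_on g B"
    using g assms(2) unfolding inj_on_def open_packing_def by (metis disjoint_iff)
  moreover have "finite S"
    using assms(1,3) finite_subset by (auto simp: total_dominating_set_def)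
  ultimately show ?thesis using g by (intro card_inj_on_le) auto
qed

lemma ditree_packing_transversal:
  assumes "ditree T" and nonempty: "\<And>v. v \<in> verts T \<Longrightarrow> in_neighbors T v \<noteq> {}"
  shows "\<exists>B S. open_packing T B \<and> total_dominating_set T S \<and> card S \<le> card B"
proof -
  let ?V = "verts T" and ?R = "parcs (mk_symmetric T)" and ?N = "in_neighbors T"
  interpret digraph T using assms(1) by (simp add: ditree_def)
  interpret M: pair_digraph "mk_symmetric T" by (rule digraph_mk_symmetric)
  interpret M: pair_graph "mk_symmetric T"
    by unfold_locales (rule symmetric_mk_symmetric)
  \<comment> \<open>Both directions are recorded because the parent property is applied at
    \<open>v\<close> as well as at an in-neighbour of \<open>v\<close>.\<close>
  have N: "y \<in> ?V" "(v, y) \<in> ?R" "(y, v) \<in> ?R" if "y \<in> ?N v" for v y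
    using that by (auto simp: in_neighbors_def parcs_mk_symmetric arcs_ends_conv)
  have "\<exists>f :: 'a \<Rightarrow> nat. inj_on f ?V \<and> (\<forall>v\<in>?V. \<forall>x\<in>?V. \<forall>y\<in>?V.
    (v, x) \<in> ?R \<longrightarrow> (v, y) \<in> ?R \<longrightarrow> f v < f x \<longrightarrow> f v < f y \<longrightarrow> x = y)"
    using assms(1) M.acyclic_low_degree
    by (intro elimination_order_exists) (auto simp: ditree_def)
  then obtain f :: "'a \<Rightarrow> nat" where inj: "inj_on f ?V"
    and parent: "\<And>v x y. v \<in> ?V \<Longrightarrow> x \<in> ?V \<Longrightarrow> y \<in> ?V \<Longrightarrow>
      (v, x) \<in> ?R \<Longrightarrow> (v, y) \<in> ?R \<Longrightarrow> f v < f x \<Longrightarrow> f v < f y \<Longrightarrow> x = y"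
    by blast
  have "\<exists>v\<in>W. \<exists>x\<in>?N v. \<forall>w\<in>W. ?N v \<inter> ?N w \<noteq> {} \<longrightarrow> x \<in> ?N w"
    if W: "W \<subseteq> ?V" "W \<noteq> {}" for W
  proof -
    obtain v where v: "v \<in> W" "\<And>w. w \<in> W \<Longrightarrow> f v \<le> f w"
      using W(2) ex_has_least_nat[of "\<lambda>v. v \<in> W" _ f] by blast
    \<comment> \<open>If a common in-neighbour \<open>y\<close> preceded \<open>v\<close>, the first
      vertex of \<open>W\<close>, then \<open>v\<close> and \<open>w\<close> would be two distinct
      later neighbours of \<open>y\<close>.\<close>
    have later: "f v < f y" if "w \<in> W" "w \<noteq> v" "y \<in> ?N v" "y \<in> ?N w" for w y
    proof (rule ccontr)
      assume "\<not> f v < f y"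
      moreover have "y \<noteq> v" using N(2)[OF that(3)] M.pair_no_loops[of "(v, y)"] by auto
      ultimately have "f y < f v"
        using inj W(1) v(1) N(1)[OF that(3)] by (metis inj_onD linorder_neqE_nat subsetD)
      moreover have "f v \<le> f w" using v(2) that(1) .
      ultimately have "v = w"
        using parent[of y v w] N(1,3)[OF that(3)] N(3)[OF that(4)] W(1) v(1) that(1) by auto
      then show False using that(2) by simp
    qed
    show ?thesis
    proof (cases "\<exists>y\<in>?N v. f v < f y")
      case True
      then obtain y where y: "y \<in> ?N v" "f v < f y" by blast
      have "y \<in> ?N w" if w: "w \<in> W" "?N v \<inter> ?N w \<noteq> {}" for w
      proof (cases "w = v")
        case False
        obtain x where x: "x \<in> ?N v" "x \<in> ?N w" using w(2) by blast
        \<comment> \<open>Both are later neighbours of \<open>v\<close>, hence its parent.\<close>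
        have "x = y"
          using parent[of v x y] later[OF w(1) False x] y N[OF x(1)] N[OF y(1)] W(1) v(1) by auto
        with x show ?thesis by simp
      qed (use y in simp)
      with y v(1) show ?thesis by blast
    next
      case False
      obtain y where y: "y \<in> ?N v" using nonempty v(1) W(1) by blast
      \<comment> \<open>A shared in-neighbour would come after \<open>v\<close>, so \<open>v\<close>
        shares none with another member of \<open>W\<close>.\<close>
      have "w = v" if "w \<in> W" "?N v \<inter> ?N w \<noteq> {}" for w
        using False later[OF that(1)] that(2) by blast
      with y v(1) show ?thesis by blast
    qed
  qed
  from greedy_packing_transversal[OF finite_verts this]
  obtain B S where BS: "B \<subseteq> ?V" "\<forall>u\<in>B. \<forall>v\<in>B. u \<noteq> v \<longrightarrow> ?N u \<inter> ?N v = {}"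
    "S \<subseteq> \<Union>(?N ` ?V)" "card S \<le> card B" "\<forall>v\<in>?V. S \<inter> ?N v \<noteq> {}" by blast
  have "open_packing T B" using BS by (simp add: open_packing_def)
  moreover have "S \<subseteq> ?V" using BS(3) N(1) by blast
  then have "total_dominating_set T S"
    using BS(5) unfolding total_dominating_set_def out_neighbors_def in_neighbors_def by blast
  ultimately show ?thesis using BS(4) by blast
qed

theorem theorem1p3:
  fixes T :: "('a, 'b) pre_digraph"
  assumes "ditree T"
    and "min_in_degree T \<ge> 1"
  shows "open_packing_number T = total_domination_number T"
proof -
  interpret digraph T using assms(1) by (simp add: ditree_def)
  have "in_neighbors T v \<noteq> {}" if "v \<in> verts T" for v
  proof -
    have "min_in_degree T \<le> card (in_neighbors T v)"
      unfolding min_in_degree_def using that by (intro Min_le) auto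
    with assms(2) show ?thesis by auto
  qed
  then obtain B S where BS: "open_packing T B" "total_dominating_set T S" "card S \<le> card B"
    using ditree_packing_transversal[OF assms(1)] by blast
  have weak: "card B' \<le> card S'" if "open_packing T B'" "total_dominating_set T S'" for B' S'
    using open_packing_card_le_total_dominating_set[OF finite_verts that] .
  \<comment> \<open>The general bound gives the reverse inequality, so \<open>B\<close> and
    \<open>S\<close> certify each other as optimal.\<close>
  have eq: "card S = card B" using BS weak by (simp add: le_antisym)
  \<comment> \<open>\<open>Max\<close> and \<open>Min\<close> have their intended meaning only on
    finite nonempty sets.\<close>
  have "{B. open_packing T B} \<subseteq> Pow (verts T)" "{S. total_dominating_set T S} \<subseteq> Pow (verts T)"
    by (auto simp: open_packing_def total_dominating_set_def)
  then have fin: "finite {B. open_packing T B}" "finite {S. total_dominating_set T S}"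
    by (auto intro: finite_subset)
  have "open_packing_number T = card B"
    unfolding open_packing_number_def
  proof (rule Max_eqI)
    show "y \<le> card B" if "y \<in> card ` {B. open_packing T B}" for y
      using that weak[OF _ BS(2)] eq by auto
  qed (use fin BS(1) in auto)
  moreover have "total_domination_number T = card S"
    unfolding total_domination_number_def
  proof (rule Min_eqI)
    show "card S \<le> y" if "y \<in> card ` {S. total_dominating_set T S}" for y
      using that weak[OF BS(1)] eq by auto
  qed (use fin BS(2) in auto)
  ultimately show ?thesis using eq by simp
qed

end
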